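(* Let $q$ be a power of a prime $p$, and let $C$ be a (full-length) $\mathbb{F}_q$-linear two-weight code with non-zero weights $w_1<w_2$ such that $w_2-w_1$ is not a power of $p$. If $C$ does not have full support, then $C$ is repetitive; more precisely, $C$ is (up to equivalence) the $l$-fold repetition of a smaller two-weight code $C'$, where $l$ is the largest factor of $w_2-w_1$ that is coprime to the field size $q$.
   Context: An $[n,k]_q$-code is a $k$-dimensional linear subspace $C$ of $\mathbb{F}_q^n$. The weight of a codeword is its number of non-zero coordinates. $C$ is a two-weight code if the non-zero codewords attain exactly two different weights. $C$ is of full length if no coordinate is zero on all of $C$, equivalently all columns of a generator matrix are non-zero. Codes are assumed to be of full length. Codes are considered equivalent if they differ by a permutation of coordinates and multiplication of coordinates by non-zero scalars. Powers of $p$ are the numbers $p^j$ with $j\ge 0$. To a full-length $[n,k]_q$-code $C$ with generator matrix $G$ one associates the multiset of points $\mathcal{M}\colon\mathcal{P}\to\mathbb{N}$ in $\operatorname{PG}(k-1,q)$, where $\mathcal{P}$ is the set of $1$-dimensional subspaces of $\mathbb{F}_q^k$ and $\mathcal{M}(P)$ is the number of columns of $G$ that span $P$. The code $C$ has full support if $\mathcal{M}(P)>0$ for all $P\in\mathcal{P}$. The $l$-fold repetition of an $[n',k]_q$-code $C'$ is the $[ln',k]_q$-code $\{(c',\dots,c'):c'\in C'\}$ with $l$ blocks. $C$ is repetitive if (up to equivalence) it is the $l$-fold repetition of an $[n/l,k]_q$-code for some integer $l>1$. *)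

theory Defs
  imports
    "Jordan_Normal_Form.VS_Connect"
    "HOL-Library.Cardinality"
    "HOL-Combinatorics.Permutations"
    "HOL-Computational_Algebra.Primes"
begin

text \<open>
  The field \<open>\<F>\<^sub>q\<close> is a type \<open>'a :: {finite, field}\<close> with \<open>q = CARD('a)\<close>, and \<open>\<F>\<^sub>q\<^sup>n\<close> is
  \<open>carrier_vec n\<close>.
\<close>

definition linear_code :: "nat \<Rightarrow> nat \<Rightarrow> 'a :: field vec set \<Rightarrow> bool" where
  "linear_code n k C \<longleftrightarrow>
     VectorSpace.subspace class_ring C (module_vec TYPE('a) n) \<and>
     vectorspace.dim class_ring (module_vec TYPE('a) n\<lparr>carrier := C\<rparr>) = k"

definition full_length :: "nat \<Rightarrow> 'a :: zero vec set \<Rightarrow> bool" where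
  "full_length n C \<longleftrightarrow> (\<forall>i<n. \<exists>c\<in>C. c $ i \<noteq> 0)"

definition weight :: "'a :: zero vec \<Rightarrow> nat" where
  "weight c = card {i. i < dim_vec c \<and> c $ i \<noteq> 0}"

definition nonzero_weights :: "nat \<Rightarrow> 'a :: zero vec set \<Rightarrow> nat set" where
  "nonzero_weights n C = weight ` (C - {0\<^sub>v n})"

definition two_weight :: "nat \<Rightarrow> 'a :: zero vec set \<Rightarrow> bool" where
  "two_weight n C \<longleftrightarrow> card (nonzero_weights n C) = 2"

text \<open>As the code has dimension \<open>k\<close>, the \<open>k\<close> rows spanning it form a basis.\<close>

definition generator_matrix :: "nat \<Rightarrow> nat \<Rightarrow> 'a :: field vec set \<Rightarrow> 'a mat \<Rightarrow> bool" where
  "generator_matrix n k C G \<longleftrightarrow>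
     linear_code n k C \<and> G \<in> carrier_mat k n \<and> vec_space.row_space n G = C"

definition points :: "nat \<Rightarrow> 'a :: field vec set set" where
  "points k = {P. linear_code k 1 P}"

definition point_mult :: "'a :: field mat \<Rightarrow> 'a vec set \<Rightarrow> nat" where
  "point_mult G P =
     card {j. j < dim_col G \<and>
       LinearCombinations.module.span class_ring (module_vec TYPE('a) (dim_row G)) {col G j} = P}"

text \<open>
  Two generator matrices differ by an invertible matrix, which permutes the points, so the
  condition does not depend on the choice of \<open>G\<close>.
\<close>

definition full_support :: "nat \<Rightarrow> nat \<Rightarrow> 'a :: field vec set \<Rightarrow> bool" where
  "full_support n k C \<longleftrightarrow>
     (\<forall>G. generator_matrix n k C G \<longrightarrow> (\<forall>P \<in> points k. point_mult G P > 0))"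

definition code_equiv :: "nat \<Rightarrow> 'a :: field vec set \<Rightarrow> 'a vec set \<Rightarrow> bool" where
  "code_equiv n C D \<longleftrightarrow>
     (\<exists>\<pi> a. \<pi> permutes {..<n} \<and> (\<forall>i<n. a i \<noteq> 0) \<and>
            D = (\<lambda>c. vec n (\<lambda>i. a i * c $ \<pi> i)) ` C)"

definition repetition :: "nat \<Rightarrow> nat \<Rightarrow> 'a vec set \<Rightarrow> 'a vec set" where
  "repetition l m C = (\<lambda>c. vec (l * m) (\<lambda>i. c $ (i mod m))) ` C"

definition repetitive :: "nat \<Rightarrow> nat \<Rightarrow> 'a :: field vec set \<Rightarrow> bool" where
  "repetitive n k C \<longleftrightarrow>
     (\<exists>l>1. l dvd n \<and>
        (\<exists>C'. linear_code (n div l) k C' \<and> full_length (n div l) C' \<and>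
              code_equiv n C (repetition l (n div l) C')))"

end

theory Submission
  imports Defs
begin

text \<open>
  Let the columns of a generator matrix be \<open>g\<^sub>j\<close>, so that the codewords are the vectors with entries
  \<open>g\<^sub>j \<bullet> h\<close> for \<open>h\<close> in the \<open>k\<close>-dimensional space over the field with \<open>q\<close> elements. Fix a nonzero
  vector \<open>x\<close>, let \<open>A\<close> be the set of \<open>h\<close> with \<open>x \<bullet> h = 1\<close>, and sum the weights of the codewords of
  all \<open>h\<close> in \<open>A\<close> in two ways. Projectively, \<open>A\<close> is a set of representatives of the hyperplanes that
  avoid the point spanned by \<open>x\<close>, and it has \<open>a = q\<^bsup>k - 1\<^esup>\<close> elements whatever \<open>x\<close> is.

  By coordinates: if \<open>g\<^sub>j\<close> is a multiple of \<open>x\<close>, then \<open>g\<^sub>j \<bullet> h\<close> is nonzero on all of \<open>A\<close>; otherwise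
  \<open>g\<^sub>j \<bullet> h\<close> takes every field element equally often on \<open>A\<close>, so it is nonzero on a fraction
  \<open>(q - 1) / q\<close> of it. If \<open>M\<close> is the multiplicity of the point spanned by \<open>x\<close>, then \<open>q\<close> times the
  total weight is \<open>(q - 1) * a * n + a * M\<close> (\<open>sum_weights_eq\<close>). By codewords: every weight is \<open>w1\<close>
  or \<open>w2\<close>, so the same quantity is \<open>q * (a * w1 + b * (w2 - w1))\<close>, where \<open>b\<close> depends on \<open>x\<close>.
  Since \<open>C\<close> does not have full support, some point has multiplicity \<open>0\<close>; subtracting its equation
  from that of any other point leaves \<open>w2 - w1\<close> dividing \<open>a * M\<close>, for every point
  (\<open>weight_diff_dvd_point_mult\<close>). As \<open>l\<close> divides \<open>w2 - w1\<close> and is coprime to \<open>q\<close>, it divides every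
  multiplicity \<open>M\<close>.

  Hence the columns can be sorted into groups of \<open>l\<close> proportional ones. Taking one column of each
  group gives \<open>C'\<close>, and rescaling the others turns \<open>C\<close> into its \<open>l\<close>-fold repetition
  (\<open>dvd_point_mult_imp_repetition\<close>). Finally \<open>l > 1\<close>, because \<open>w2 - w1\<close> is not a power of \<open>p\<close> and
  so has a factor greater than \<open>1\<close> that is coprime to \<open>p\<close>.

  Over a finite field the dimension of a code can be read off from its number of elements
  (\<open>linear_code_iff_card\<close>); dimensions enter only through this.
\<close>

section \<open>Linear codes over a finite field as sets of known cardinality\<close>

lemma card_field_gt_1: "CARD('a :: {finite, field}) > 1"
proof -
  have "card {0, 1 :: 'a} \<le> CARD('a)" by (intro card_mono) auto
  then show ?thesis by simp
qed

lemma finite_carrier_vec: "finite (carrier_vec n :: 'a :: finite vec set)"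
proof (rule finite_subset)
  show "(carrier_vec n :: 'a vec set) \<subseteq> vec_of_list ` {xs. set xs \<subseteq> UNIV \<and> length xs = n}"
  proof
    fix v :: "'a vec" assume "v \<in> carrier_vec n"
    then have "v = vec_of_list (list_of_vec v)" "length (list_of_vec v) = n"
      by (auto simp: vec_list)
    then show "v \<in> vec_of_list ` {xs. set xs \<subseteq> UNIV \<and> length xs = n}" by blast
  qed
  show "finite (vec_of_list ` {xs :: 'a list. set xs \<subseteq> UNIV \<and> length xs = n})"
    by (intro finite_imageI finite_lists_length_eq finite)
qed

text \<open>Coordinates with respect to a basis identify the space with the functions from the basis to
  the field.\<close>

lemma (in vectorspace) card_carrier_eq_power_dim:
  assumes fin: "finite (carrier V)"
  shows "card (carrier V) = card (carrier K) ^ dim"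
proof -
  have "gen_set (carrier V)"
    using in_own_span[of "carrier V"] span_is_subset2[of "carrier V"] by auto
  with fin have "fin_dim" unfolding fin_dim_def by blast
  then obtain B where B: "finite B" "basis B" using finite_basis_exists by blast
  then have BV: "B \<subseteq> carrier V" by (simp add: basis_def)
  have unique: "\<exists>!a. a \<in> B \<rightarrow>\<^sub>E carrier K \<and> lincomb a B = v" if "v \<in> carrier V" for v
    using basis_criterion[OF B(1) BV] B(2) that by blast
  have closed: "lincomb a B \<in> carrier V" if "a \<in> B \<rightarrow>\<^sub>E carrier K" for a
    using BV that by (intro lincomb_closed) (auto simp: PiE_def)
  have "bij_betw (\<lambda>a. lincomb a B) (B \<rightarrow>\<^sub>E carrier K) (carrier V)"
    unfolding bij_betw_def
  proof
    show "inj_on (\<lambda>a. lincomb a B) (B \<rightarrow>\<^sub>E carrier K)"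
      using unique closed unfolding inj_on_def by metis
    show "(\<lambda>a. lincomb a B) ` (B \<rightarrow>\<^sub>E carrier K) = carrier V"
      using unique closed by blast
  qed
  then have "card (carrier V) = card (B \<rightarrow>\<^sub>E carrier K)" by (simp add: bij_betw_same_card)
  also have "\<dots> = card (carrier K) ^ card B" by (simp add: card_PiE[OF B(1)])
  finally show ?thesis using dim_basis[OF B] by simp
qed

lemma card_carrier_vec: "card (carrier_vec n :: 'a :: {finite, field} vec set) = CARD('a) ^ n"
proof -
  interpret vec_space "TYPE('a)" n .
  show ?thesis
    using card_carrier_eq_power_dim finite_carrier_vec[of n, where 'a='a] dim_is_n by simp
qed

lemma subspace_vec_iff:
  fixes C :: "'a :: field vec set"
  shows "VectorSpace.subspace class_ring C (module_vec TYPE('a) n) \<longleftrightarrow>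
     C \<subseteq> carrier_vec n \<and> 0\<^sub>v n \<in> C \<and> (\<forall>v\<in>C. \<forall>w\<in>C. v + w \<in> C) \<and> (\<forall>a. \<forall>v\<in>C. a \<cdot>\<^sub>v v \<in> C)"
proof -
  interpret vec_space "TYPE('a)" n .
  show ?thesis
    unfolding VectorSpace.subspace_def submodule_def
    using vec_vs[of n, where 'a='a] vec_module[of n, where 'a='a]
    by (auto simp: module_vec_simps class_ring_simps)
qed

text \<open>With the dimension replaced by the cardinality, any injective linear image of a code is seen
  to have the same dimension, and a surjective parametrisation by a space of the right size is
  seen to be injective.\<close>

lemma linear_code_iff_card:
  fixes C :: "'a :: {finite, field} vec set"
  shows "linear_code n k C \<longleftrightarrow>
     C \<subseteq> carrier_vec n \<and> 0\<^sub>v n \<in> C \<and> (\<forall>v\<in>C. \<forall>w\<in>C. v + w \<in> C) \<and> (\<forall>a. \<forall>v\<in>C. a \<cdot>\<^sub>v v \<in> C) \<and>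
     card C = CARD('a) ^ k"
proof -
  have "card C = CARD('a) ^ vectorspace.dim class_ring (module_vec TYPE('a) n\<lparr>carrier := C\<rparr>)"
    if sub: "VectorSpace.subspace class_ring C (module_vec TYPE('a) n)"
  proof -
    interpret vec_space "TYPE('a)" n .
    interpret C: vectorspace class_ring "module_vec TYPE('a) n\<lparr>carrier := C\<rparr>"
      using subspace_is_vs[OF sub] by simp
    have "finite C" using sub finite_subset[OF _ finite_carrier_vec] by (auto simp: subspace_vec_iff)
    then show ?thesis using C.card_carrier_eq_power_dim by simp
  qed
  moreover have "CARD('a) > 1" by (rule card_field_gt_1)
  ultimately show ?thesis
    unfolding linear_code_def subspace_vec_iff[symmetric] by (auto simp: subspace_vec_iff)
qed


definition line :: "'a :: field vec \<Rightarrow> 'a vec set" where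
  "line x = range (\<lambda>c. c \<cdot>\<^sub>v x)"

lemma span_singleton:
  fixes x :: "'a :: field vec"
  assumes "x \<in> carrier_vec k"
  shows "LinearCombinations.module.span class_ring (module_vec TYPE('a) k) {x} = line x"
proof -
  interpret vec_space "TYPE('a)" k .
  have "lincomb a {x} = a x \<cdot>\<^sub>v x" for a
    using assms by (auto simp: lincomb_def)
  then have "span {x} = (\<lambda>a. a x \<cdot>\<^sub>v x) ` UNIV"
    using finite_span[of "{x}"] assms by auto
  also have "\<dots> = line x"
  proof
    show "line x \<subseteq> (\<lambda>a. a x \<cdot>\<^sub>v x) ` UNIV"
      unfolding line_def by (auto intro!: image_eqI[where x = "\<lambda>_. _"])
  qed (auto simp: line_def)
  finally show ?thesis .
qed

lemma in_line_self: "x \<in> line (x :: 'a :: field vec)"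
  unfolding line_def by (auto intro!: image_eqI[of _ _ 1])

lemma line_eq_iff:
  fixes x y :: "'a :: field vec"
  assumes "x \<in> carrier_vec k" "y \<in> carrier_vec k" "y \<noteq> 0\<^sub>v k"
  shows "line y = line x \<longleftrightarrow> y \<in> line x"
proof
  assume "y \<in> line x"
  then obtain c where c: "y = c \<cdot>\<^sub>v x" by (auto simp: line_def)
  with assms have "c \<noteq> 0" by auto
  have "a \<cdot>\<^sub>v y = (a * c) \<cdot>\<^sub>v x" "a \<cdot>\<^sub>v x = (a / c) \<cdot>\<^sub>v y" for a
    using c \<open>c \<noteq> 0\<close> by (auto simp: smult_smult_assoc)
  then show "line y = line x" unfolding line_def by (blast intro: range_eqI)
qed (use in_line_self[of y] in simp)

lemma point_eq_line:
  fixes P :: "'a :: {finite, field} vec set"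
  assumes "P \<in> points k"
  obtains x where "x \<in> carrier_vec k" "x \<noteq> 0\<^sub>v k" "P = line x"
proof -
  from assms have P: "P \<subseteq> carrier_vec k" "0\<^sub>v k \<in> P" "\<And>a v. v \<in> P \<Longrightarrow> a \<cdot>\<^sub>v v \<in> P"
    "card P = CARD('a)"
    by (auto simp: points_def linear_code_iff_card)
  have "P \<noteq> {0\<^sub>v k}" using P(4) card_field_gt_1[where 'a='a] by auto
  with P obtain x where x: "x \<in> P" "x \<noteq> 0\<^sub>v k" by blast
  have "inj (\<lambda>c. c \<cdot>\<^sub>v x)"
  proof (rule injI)
    fix c d assume eq: "c \<cdot>\<^sub>v x = d \<cdot>\<^sub>v x"
    from x P(1) obtain i where "i < k" "x $ i \<noteq> 0" by (metis carrier_vecD eq_vecI index_zero_vec subsetD)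
    moreover have "(c \<cdot>\<^sub>v x) $ i = (d \<cdot>\<^sub>v x) $ i" using eq by simp
    ultimately show "c = d" using x P(1) by auto
  qed
  then have "card (line x) = card P" unfolding line_def by (simp add: card_image P(4))
  moreover have "line x \<subseteq> P" using P(3) x by (auto simp: line_def)
  moreover have "finite P" using P(1) finite_carrier_vec finite_subset by blast
  ultimately have "line x = P" by (intro card_subset_eq)
  with x P(1) show thesis by (intro that[of x]) auto
qed

section \<open>Equidistribution of inner products\<close>

text \<open>Translation by \<open>(d - c) \<cdot>\<^sub>v u\<close> maps the fibre over \<open>c\<close> injectively into the fibre over \<open>d\<close>, so all
  \<open>CARD('a)\<close> fibres have the same size.\<close>

lemma card_fibre_scalar_prod:
  fixes S :: "'a :: {finite, field} vec set"
  assumes S: "S \<subseteq> carrier_vec k" and y: "y \<in> carrier_vec k"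
    and u: "u \<in> carrier_vec k" "y \<bullet> u = 1"
    and shift: "\<And>s t. s \<in> S \<Longrightarrow> s + t \<cdot>\<^sub>v u \<in> S"
  shows "CARD('a) * card {s \<in> S. y \<bullet> s = c} = card S"
proof -
  define F where "F c = {s \<in> S. y \<bullet> s = c}" for c
  have fin: "finite S" using S finite_carrier_vec finite_subset by blast
  have le: "card (F c) \<le> card (F d)" for c d
  proof (rule card_inj_on_le)
    show "finite (F d)" using fin by (simp add: F_def)
    show "inj_on (\<lambda>s. s + (d - c) \<cdot>\<^sub>v u) (F c)"
    proof (rule inj_onI)
      fix s t assume st: "s \<in> F c" "t \<in> F c" "s + (d - c) \<cdot>\<^sub>v u = t + (d - c) \<cdot>\<^sub>v u"
      then have "s \<in> carrier_vec k" "t \<in> carrier_vec k" using S by (auto simp: F_def)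
      with st(3) u show "s = t"
        by (intro eq_vecI; simp) (metis add_right_cancel carrier_vecD index_add_vec(1) smult_carrier_vec)
    qed
    show "(\<lambda>s. s + (d - c) \<cdot>\<^sub>v u) ` F c \<subseteq> F d"
    proof
      fix v assume "v \<in> (\<lambda>s. s + (d - c) \<cdot>\<^sub>v u) ` F c"
      then obtain s where s: "s \<in> S" "y \<bullet> s = c" "v = s + (d - c) \<cdot>\<^sub>v u" by (auto simp: F_def)
      with S y u have "y \<bullet> v = c + (d - c) * 1"
        by (subst s(3), subst scalar_prod_add_distrib[of _ k]) auto
      with s shift show "v \<in> F d" by (auto simp: F_def)
    qed
  qed
  have "S = (\<Union>d. F d)" by (auto simp: F_def)
  then have "card S = (\<Sum>d\<in>UNIV. card (F d))"
    using fin by (simp only:) (intro card_UN_disjoint; auto simp: F_def)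
  also have "\<dots> = (\<Sum>d\<in>(UNIV :: 'a set). card (F c))"
    by (intro sum.cong refl le antisym)
  finally show ?thesis by (simp add: F_def)
qed

lemma card_scalar_prod_eq_1:
  fixes x :: "'a :: {finite, field} vec"
  assumes x: "x \<in> carrier_vec k" "x \<noteq> 0\<^sub>v k"
  shows "CARD('a) * card {h \<in> carrier_vec k. x \<bullet> h = 1} = CARD('a) ^ k"
proof -
  from x obtain i where i: "i < k" "x $ i \<noteq> 0" by (metis carrier_vecD eq_vecI index_zero_vec)
  show ?thesis
    unfolding card_carrier_vec[symmetric]
    by (rule card_fibre_scalar_prod[of _ k _ "(1 / x $ i) \<cdot>\<^sub>v unit_vec k i"])
      (use x i in auto)
qed

text \<open>The count behind the whole proof: membership of \<open>y\<close> in the line of \<open>x\<close> is visible in how often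
  \<open>y \<bullet> h\<close> vanishes on the affine hyperplane \<open>x \<bullet> h = 1\<close>. Normalising to \<open>1\<close>, instead of ranging over
  all \<open>h\<close> with \<open>x \<bullet> h \<noteq> 0\<close>, picks one representative of each hyperplane and so keeps a
  factor \<open>CARD('a) - 1\<close>, which may share divisors with \<open>w2 - w1\<close>, out of the final divisibility.
  Multiplying by \<open>CARD('a)\<close> avoids fractions.\<close>

lemma card_scalar_prod_eq_1_and_nonzero:
  fixes x y :: "'a :: {finite, field} vec"
  assumes x: "x \<in> carrier_vec k" "x \<noteq> 0\<^sub>v k" and y: "y \<in> carrier_vec k" "y \<noteq> 0\<^sub>v k"
  defines "A \<equiv> {h \<in> carrier_vec k. x \<bullet> h = 1}"
  shows "CARD('a) * card {h \<in> A. y \<bullet> h \<noteq> 0} =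
    (CARD('a) - 1) * card A + (if y \<in> line x then card A else 0)"
proof (cases "y \<in> line x")
  case True
  then obtain c where c: "y = c \<cdot>\<^sub>v x" by (auto simp: line_def)
  with x y have "c \<noteq> 0" by auto
  then have "{h \<in> A. y \<bullet> h \<noteq> 0} = A" using c x by (auto simp: A_def)
  then show ?thesis using True card_field_gt_1[where 'a='a]
    by (simp add: diff_mult_distrib)
next
  case False
  \<comment> \<open>A translation vector \<open>u\<close> that is orthogonal to \<open>x\<close> and has product \<open>1\<close> with \<open>y\<close>: subtracting
    \<open>c \<cdot>\<^sub>v x\<close> from \<open>y\<close> clears entry \<open>i\<close>, and some other entry \<open>j\<close> survives because \<open>y\<close> is not a
    multiple of \<open>x\<close>.\<close>
  from x obtain i where i: "i < k" "x $ i \<noteq> 0" by (metis carrier_vecD eq_vecI index_zero_vec)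
  define c where "c = y $ i / x $ i"
  have "y \<noteq> c \<cdot>\<^sub>v x" using False by (auto simp: line_def)
  with x y obtain j where j: "j < k" "y $ j \<noteq> c * x $ j"
    by (metis carrier_vecD eq_vecI index_smult_vec)
  define e where "e = y $ j - c * x $ j"
  have e: "e \<noteq> 0" using j by (simp add: e_def)
  define u where "u = (1 / e) \<cdot>\<^sub>v (unit_vec k j - (x $ j / x $ i) \<cdot>\<^sub>v unit_vec k i)"
  have u: "u \<in> carrier_vec k" by (simp add: u_def)
  have prod_u: "z \<bullet> u = (z $ j - x $ j / x $ i * z $ i) / e" if "z \<in> carrier_vec k" for z
    using that i j unfolding u_def
    by (simp add: scalar_prod_minus_distrib[of _ k])
  have "x \<bullet> u = 0" using prod_u[OF x(1)] i by simp
  moreover have "y \<bullet> u = 1" using prod_u[OF y(1)] i e by (simp add: e_def c_def)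
  ultimately have "CARD('a) * card {h \<in> A. y \<bullet> h = 0} = card A"
    by (intro card_fibre_scalar_prod[of _ k _ u])
      (use x y u in \<open>auto simp: A_def scalar_prod_add_distrib[of _ k]\<close>)
  moreover have "card A = card {h \<in> A. y \<bullet> h = 0} + card {h \<in> A. y \<bullet> h \<noteq> 0}"
    by (subst card_Un_disjoint[symmetric])
      (auto simp: A_def finite_carrier_vec intro!: arg_cong[where f = card])
  moreover obtain m where "CARD('a) = Suc m"
    using card_field_gt_1[where 'a='a] by (metis not_less0 not0_implies_Suc)
  ultimately show ?thesis using False by (simp add: algebra_simps)
qed

section \<open>Weights and point multiplicities\<close>

definition codeword :: "'a :: field mat \<Rightarrow> 'a vec \<Rightarrow> 'a vec" where
  "codeword G h = vec (dim_col G) (\<lambda>j. col G j \<bullet> h)"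

text \<open>The rows span \<open>C\<close>, so \<open>codeword G\<close> maps onto \<open>C\<close>; both sides have \<open>CARD('a) ^ k\<close> elements.\<close>

lemma bij_betw_codeword:
  fixes C :: "'a :: {finite, field} vec set"
  assumes G: "generator_matrix n k C G"
  shows "bij_betw (codeword G) (carrier_vec k) C"
proof -
  interpret vec_space "TYPE('a)" n .
  from G have dim: "dim_row G = k" "dim_col G = n" and carr: "G \<in> carrier_mat k n"
    and C: "linear_code n k C" "row_space G = C"
    by (auto simp: generator_matrix_def)
  have "codeword G h = G\<^sup>T *\<^sub>v h" for h
    by (auto simp: codeword_def)
  then have "C = codeword G ` carrier_vec k"
    using C(2) row_space_eq[OF carr] dim mult_mat_vec_carrier[of "G\<^sup>T" n k] carr by auto
  moreover from this have "card (codeword G ` carrier_vec k) = card (carrier_vec k :: 'a vec set)"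
    using C(1) by (simp add: linear_code_iff_card card_carrier_vec)
  then have "inj_on (codeword G) (carrier_vec k)"
    by (intro eq_card_imp_inj_on finite_carrier_vec)
  ultimately show ?thesis by (simp add: bij_betw_def)
qed

lemma col_nonzero:
  assumes G: "generator_matrix n k C G" and full: "full_length n (C :: 'a :: {finite, field} vec set)"
    and j: "j < n"
  shows "col G j \<noteq> 0\<^sub>v k"
proof
  assume 0: "col G j = 0\<^sub>v k"
  from full j obtain c where c: "c \<in> C" "c $ j \<noteq> 0" by (auto simp: full_length_def)
  with bij_betw_codeword[OF G] obtain h where "h \<in> carrier_vec k" "c = codeword G h"
    by (auto simp: bij_betw_def)
  moreover have "dim_col G = n" using G by (auto simp: generator_matrix_def)
  ultimately show False using c(2) j 0 by (auto simp: codeword_def)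
qed

lemma point_mult_line:
  assumes G: "generator_matrix n k C G" and full: "full_length n (C :: 'a :: {finite, field} vec set)"
    and x: "x \<in> carrier_vec k"
  shows "point_mult G (line x) = card {j. j < n \<and> col G j \<in> line x}"
proof -
  have dim: "dim_row G = k" "dim_col G = n" using G by (auto simp: generator_matrix_def)
  have "col G j \<in> carrier_vec k" for j using dim by auto
  then show ?thesis unfolding point_mult_def dim
    using line_eq_iff[OF x _ col_nonzero[OF G full]]
    by (intro arg_cong[where f = card] Collect_cong conj_cong) (auto simp: span_singleton)
qed

text \<open>Interchanging the sums over \<open>A\<close> and over the coordinates reduces this to
  \<open>card_scalar_prod_eq_1_and_nonzero\<close>, applied to each column.\<close>

lemma sum_weights_eq:
  fixes C :: "'a :: {finite, field} vec set" and x :: "'a vec"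
  assumes G: "generator_matrix n k C G" and full: "full_length n C"
    and x: "x \<in> carrier_vec k" "x \<noteq> 0\<^sub>v k"
  defines "A \<equiv> {h \<in> carrier_vec k. x \<bullet> h = 1}"
  shows "CARD('a) * (\<Sum>h\<in>A. weight (codeword G h)) =
    (CARD('a) - 1) * card A * n + card A * point_mult G (line x)"
proof -
  have dim: "dim_row G = k" "dim_col G = n" using G by (auto simp: generator_matrix_def)
  have finA: "finite A" by (simp add: A_def finite_carrier_vec)
  have "weight (codeword G h) = (\<Sum>j<n. if col G j \<bullet> h \<noteq> 0 then 1 else 0)" for h
  proof -
    have "weight (codeword G h) = card {j \<in> {..<n}. col G j \<bullet> h \<noteq> 0}"
      unfolding weight_def codeword_def dim by (intro arg_cong[where f = card]) (auto simp: dim)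
    then show ?thesis by (simp add: sum.If_cases Int_def)
  qed
  then have "(\<Sum>h\<in>A. weight (codeword G h)) = (\<Sum>h\<in>A. \<Sum>j<n. if col G j \<bullet> h \<noteq> 0 then 1 else 0)"
    by simp
  also have "\<dots> = (\<Sum>j<n. \<Sum>h\<in>A. if col G j \<bullet> h \<noteq> 0 then 1 else 0)" by (rule sum.swap)
  also have "\<dots> = (\<Sum>j<n. card {h \<in> A. col G j \<bullet> h \<noteq> 0})"
    using finA by (simp add: sum.If_cases Int_def)
  finally have "CARD('a) * (\<Sum>h\<in>A. weight (codeword G h)) =
      (\<Sum>j<n. CARD('a) * card {h \<in> A. col G j \<bullet> h \<noteq> 0})"
    by (simp add: sum_distrib_left)
  also have "\<dots> = (\<Sum>j<n. (CARD('a) - 1) * card A + (if col G j \<in> line x then card A else 0))"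
    unfolding A_def using x dim col_nonzero[OF G full]
    by (intro sum.cong refl card_scalar_prod_eq_1_and_nonzero) auto
  also have "\<dots> = n * ((CARD('a) - 1) * card A) + card A * card {j. j < n \<and> col G j \<in> line x}"
    by (simp add: sum.distrib sum.If_cases Int_def)
  finally show ?thesis unfolding point_mult_line[OF G full x(1)] by (simp add: algebra_simps)
qed

text \<open>The terms \<open>(q - 1) * a * n\<close> and \<open>q * a * w1\<close> of the two counts are the same for all points;
  comparison with a point of multiplicity \<open>0\<close> cancels them.\<close>

lemma weight_diff_dvd_point_mult:
  fixes C :: "'a :: {finite, field} vec set"
  assumes G: "generator_matrix n k C G" and full: "full_length n C"
    and weights: "nonzero_weights n C = {w1, w2}" and le: "w1 \<le> w2"
    and missing: "P0 \<in> points k" "point_mult G P0 = 0"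
    and x: "x \<in> carrier_vec k" "x \<noteq> 0\<^sub>v k"
  shows "w2 - w1 dvd CARD('a) ^ k * point_mult G (line x)"
proof -
  define q where "q = CARD('a)"
  define A where "A x = {h \<in> carrier_vec k. x \<bullet> h = 1}" for x :: "'a vec"
  define b where "b x = card {h \<in> A x. weight (codeword G h) = w2}" for x
  have finA: "finite (A x)" for x by (simp add: A_def finite_carrier_vec)
  have weight: "weight (codeword G h) \<in> {w1, w2}" if h: "h \<in> A x" "x \<in> carrier_vec k" for h x
  proof -
    have "h \<in> carrier_vec k" "h \<noteq> 0\<^sub>v k" using h by (auto simp: A_def)
    moreover have "codeword G (0\<^sub>v k) = 0\<^sub>v n"
      using G by (auto simp: codeword_def generator_matrix_def)
    ultimately have "codeword G h \<in> C - {0\<^sub>v n}"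
      using bij_betw_codeword[OF G] zero_carrier_vec[of k]
      by (auto simp: bij_betw_def) (metis inj_on_contraD zero_carrier_vec)
    then show ?thesis using weights by (auto simp: nonzero_weights_def)
  qed
  have sum_weights: "(\<Sum>h\<in>A x. weight (codeword G h)) = card (A x) * w1 + b x * (w2 - w1)"
    if x: "x \<in> carrier_vec k" for x
  proof -
    have "(\<Sum>h\<in>A x. weight (codeword G h)) =
        (\<Sum>h\<in>A x. w1 + (if weight (codeword G h) = w2 then w2 - w1 else 0))"
      using weight[OF _ x] le by (intro sum.cong) auto
    then show ?thesis using finA by (simp add: sum.distrib sum.If_cases Int_def b_def)
  qed
  obtain x0 where x0: "x0 \<in> carrier_vec k" "x0 \<noteq> 0\<^sub>v k" "P0 = line x0"
    by (rule point_eq_line[OF missing(1)])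
  have cardA: "q * card (A x0) = q ^ k" "q * card (A x) = q ^ k"
    unfolding A_def q_def using x x0 by (auto intro: card_scalar_prod_eq_1)
  then have same: "card (A x0) = card (A x)" using card_field_gt_1[where 'a='a]
    by (metis mult_left_cancel not_less0 q_def)
  have "q * (card (A x) * w1 + b x0 * (w2 - w1)) = (q - 1) * card (A x) * n"
    using sum_weights_eq[OF G full x0(1,2)] sum_weights[OF x0(1)] missing(2)
    by (simp add: x0(3)[symmetric] A_def[symmetric] q_def same)
  moreover have "q * (card (A x) * w1 + b x * (w2 - w1)) =
      (q - 1) * card (A x) * n + card (A x) * point_mult G (line x)"
    using sum_weights_eq[OF G full x(1,2)] sum_weights[OF x(1)]
    by (simp add: A_def[symmetric] q_def)
  ultimately have "q * b x * (w2 - w1) = q * b x0 * (w2 - w1) + card (A x) * point_mult G (line x)"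
    by (simp add: algebra_simps)
  then have "w2 - w1 dvd card (A x) * point_mult G (line x)"
    by (metis dvd_add_right_iff dvd_triv_right)
  then show ?thesis
    unfolding q_def[symmetric] cardA(2)[symmetric] by (metis dvd_mult mult.assoc)
qed

section \<open>Sorting coordinates into blocks\<close>

lemma dvd_card_of_fibres:
  assumes "finite S" "\<And>b. l dvd card {s \<in> S. f s = b}"
  shows "l dvd card S"
proof -
  have "card S = (\<Sum>b\<in>f ` S. card {s \<in> S. f s = b})"
    using sum.image_gen[OF assms(1), of "\<lambda>_. 1 :: nat" f] by simp
  then show ?thesis using assms(2) by (simp add: dvd_sum)
qed

text \<open>Induction on the number of blocks: a nonempty fibre has at least \<open>l\<close> elements, and removing \<open>l\<close>
  of them as a new block preserves the divisibility of all fibre sizes.\<close>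

lemma arrange_in_blocks:
  fixes f :: "'a \<Rightarrow> 'b"
  assumes "finite S" "card S = l * m" "\<And>b. l dvd card {s \<in> S. f s = b}"
  shows "\<exists>\<sigma>. bij_betw (\<lambda>(i, j). \<sigma> i j) ({..<m} \<times> {..<l}) S \<and> (\<forall>i<m. \<forall>j<l. f (\<sigma> i j) = f (\<sigma> i 0))"
  using assms
proof (induction m arbitrary: S)
  case 0
  then show ?case by (auto simp: bij_betw_def)
next
  case (Suc m)
  show ?case
  proof (cases "l = 0")
    case True
    then show ?thesis using Suc.prems by (auto simp: bij_betw_def)
  next
    case False
    then obtain s where s: "s \<in> S" using Suc.prems by (metis card.empty equals0I mult_is_0 nat.simps(3))
    let ?B = "{t \<in> S. f t = f s}"
    have "card ?B > 0" using s Suc.prems(1) by (auto simp: card_gt_0_iff)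
    then have "l \<le> card ?B" using Suc.prems(3)[of "f s"] dvd_imp_le by blast
    then obtain T where T: "T \<subseteq> ?B" "card T = l" "finite T" by (rule obtain_subset_with_card_n)
    obtain \<tau> where \<tau>: "bij_betw \<tau> {..<l} T"
      using T by (metis atLeast0LessThan ex_bij_betw_nat_finite)
    have "card (S - T) = l * m"
      using T Suc.prems by (subst card_Diff_subset) auto
    moreover have "l dvd card {t \<in> S - T. f t = b}" for b
    proof (cases "b = f s")
      case True
      then have "{t \<in> S - T. f t = b} = ?B - T" by auto
      then show ?thesis using T Suc.prems(3)[of "f s"]
        by (simp add: card_Diff_subset)
    next
      case False
      then have "{t \<in> S - T. f t = b} = {t \<in> S. f t = b}" using T by auto
      then show ?thesis using Suc.prems(3)[of b] by simp
    qed
    ultimately obtain \<sigma> where \<sigma>: "bij_betw (\<lambda>(i, j). \<sigma> i j) ({..<m} \<times> {..<l}) (S - T)"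
      "\<And>i j. i < m \<Longrightarrow> j < l \<Longrightarrow> f (\<sigma> i j) = f (\<sigma> i 0)"
      using Suc.IH[of "S - T"] Suc.prems(1) by blast
    define \<rho> where "\<rho> i j = (if i = m then \<tau> j else \<sigma> i j)" for i j
    have "bij_betw (\<lambda>(i, j). \<rho> i j) ({..<m} \<times> {..<l}) (S - T)"
      using \<sigma>(1) by (rule bij_betw_cong[THEN iffD1, rotated]) (auto simp: \<rho>_def)
    moreover have "bij_betw (\<lambda>(i, j). \<rho> i j) ({m} \<times> {..<l}) T"
    proof -
      have "bij_betw snd ({m} \<times> {..<l}) {..<l}" by (auto simp: bij_betw_def inj_on_def)
      then have "bij_betw (\<tau> \<circ> snd) ({m} \<times> {..<l}) T" using \<tau> by (rule bij_betw_trans)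
      then show ?thesis by (rule bij_betw_cong[THEN iffD1, rotated]) (auto simp: \<rho>_def)
    qed
    ultimately have "bij_betw (\<lambda>(i, j). \<rho> i j) ({..<m} \<times> {..<l} \<union> {m} \<times> {..<l}) (S - T \<union> T)"
      by (rule bij_betw_combine) auto
    moreover have "{..<m} \<times> {..<l} \<union> {m} \<times> {..<l} = {..<Suc m} \<times> {..<l}" by auto
    moreover have "S - T \<union> T = S" using T by auto
    moreover have "f (\<rho> i j) = f (\<rho> i 0)" if "i < Suc m" "j < l" for i j
    proof (cases "i = m")
      case True
      have "\<tau> j \<in> T" "\<tau> 0 \<in> T" using \<tau> that(2) by (auto simp: bij_betw_def)
      then have "f (\<tau> j) = f s" "f (\<tau> 0) = f s" using T(1) by blast+
      then show ?thesis using True by (simp add: \<rho>_def)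
    next
      case False
      then show ?thesis using \<sigma>(2)[of i j] that by (simp add: \<rho>_def)
    qed
    ultimately show ?thesis by (intro exI[of _ \<rho>] conjI allI impI) metis+
  qed
qed

lemma bij_betw_mod_div:
  "bij_betw (\<lambda>i. (i mod m, i div m)) {..<l * m} ({..<m} \<times> {..<l :: nat})"
proof (rule bij_betw_byWitness[where f' = "\<lambda>(i, j). j * m + i"])
  show "(\<lambda>(i, j). j * m + i) ` ({..<m} \<times> {..<l}) \<subseteq> {..<l * m}"
  proof clarsimp
    fix i j assume "i < m" "j < l"
    then have "j * m + i < Suc j * m" "Suc j * m \<le> l * m" by (simp, intro mult_le_mono1, simp)
    then show "j * m + i < l * m" by linarith
  qed
qed (auto simp: less_mult_imp_div_less, metis mod_less_divisor mult_0_right neq0_conv not_less0)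

text \<open>Reading position \<open>i\<close> as element \<open>i div m\<close> of block \<open>i mod m\<close> puts one element of each block into
  every stretch of \<open>m\<close> consecutive positions, which is the layout of a repetition.\<close>

lemma permute_into_periodic_order:
  fixes f :: "nat \<Rightarrow> 'b"
  assumes "\<And>b. l dvd card {i. i < n \<and> f i = b}" and n: "n = l * m"
  obtains \<pi> where "\<pi> permutes {..<n}" "\<And>i. i < n \<Longrightarrow> f (\<pi> i) = f (\<pi> (i mod m))"
proof -
  obtain \<sigma> where \<sigma>: "bij_betw (\<lambda>(i, j). \<sigma> i j) ({..<m} \<times> {..<l}) {..<n}"
    "\<And>i j. i < m \<Longrightarrow> j < l \<Longrightarrow> f (\<sigma> i j) = f (\<sigma> i 0)"
    using arrange_in_blocks[of "{..<n}" l m f] assms by auto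
  define \<pi> where "\<pi> i = (if i < n then \<sigma> (i mod m) (i div m) else i)" for i
  have "bij_betw ((\<lambda>(i, j). \<sigma> i j) \<circ> (\<lambda>i. (i mod m, i div m))) {..<n} {..<n}"
    using bij_betw_mod_div \<sigma>(1) unfolding n by (rule bij_betw_trans)
  then have "bij_betw \<pi> {..<n} {..<n}"
    by (rule bij_betw_cong[THEN iffD1, rotated]) (auto simp: \<pi>_def)
  then have "\<pi> permutes {..<n}" by (rule bij_imp_permutes) (auto simp: \<pi>_def)
  moreover have "f (\<pi> i) = f (\<pi> (i mod m))" if i: "i < n" for i
  proof -
    have "i mod m < m" "i div m < l" using bij_betw_mod_div[of m l] i n by (auto simp: bij_betw_def)
    moreover from this have "i mod m < n" using i by (meson le_less_trans mod_less_eq_dividend)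
    ultimately show ?thesis using i \<sigma>(2)[of "i mod m" "i div m"] by (simp add: \<pi>_def)
  qed
  ultimately show thesis by (rule that)
qed

section \<open>Splitting off a repetition\<close>

lemma card_Collect_bij_betw:
  assumes "bij_betw \<phi> A B"
  shows "card {a \<in> A. P (\<phi> a)} = card {b \<in> B. P b}"
proof -
  have "bij_betw \<phi> {a \<in> A. P (\<phi> a)} {b \<in> B. P b}"
    using assms by (auto simp: bij_betw_def inj_on_def)
  then show ?thesis by (rule bij_betw_same_card)
qed

lemma weight_eq_card: "c \<in> carrier_vec n \<Longrightarrow> weight c = card {i \<in> {..<n}. c $ i \<noteq> 0}"
  by (auto simp: weight_def)

lemma weight_monomial:
  fixes a :: "nat \<Rightarrow> 'a :: field"
  assumes "\<pi> permutes {..<n}" "\<And>i. i < n \<Longrightarrow> a i \<noteq> 0" "c \<in> carrier_vec n"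
  shows "weight (vec n (\<lambda>i. a i * c $ \<pi> i)) = weight c"
proof -
  have "weight (vec n (\<lambda>i. a i * c $ \<pi> i)) = card {i \<in> {..<n}. c $ \<pi> i \<noteq> 0}"
    using assms(2) by (subst weight_eq_card[of _ n]) (auto intro!: arg_cong[where f = card])
  also have "\<dots> = card {i \<in> {..<n}. c $ i \<noteq> 0}"
    by (rule card_Collect_bij_betw[OF permutes_imp_bij[OF assms(1)]])
  finally show ?thesis using assms(3) by (simp add: weight_eq_card)
qed

lemma weight_repeat:
  assumes "c \<in> carrier_vec m"
  shows "weight (vec (l * m) (\<lambda>i. c $ (i mod m))) = l * weight c"
proof -
  have "weight (vec (l * m) (\<lambda>i. c $ (i mod m))) =
      card {i \<in> {..<l * m}. c $ fst (i mod m, i div m) \<noteq> 0}"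
    by (subst weight_eq_card[of _ "l * m"]) (auto intro!: arg_cong[where f = card])
  also have "\<dots> = card {z \<in> {..<m} \<times> {..<l}. c $ fst z \<noteq> 0}"
    by (rule card_Collect_bij_betw[OF bij_betw_mod_div])
  also have "{z \<in> {..<m} \<times> {..<l}. c $ fst z \<noteq> 0} = {i \<in> {..<m}. c $ i \<noteq> 0} \<times> {..<l}" by auto
  finally show ?thesis using assms by (simp add: weight_eq_card)
qed

text \<open>Columns spanning the same point are sorted into blocks of length \<open>l\<close>. Then the column at position
  \<open>i\<close> is proportional to the one at position \<open>i mod m\<close>, the scalars \<open>a i\<close> make them equal, and the
  smaller code is the projection of \<open>C\<close> to the first \<open>m\<close> positions.\<close>

lemma dvd_point_mult_imp_repetition:
  fixes C :: "'a :: {finite, field} vec set"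
  assumes G: "generator_matrix n k C G" and full: "full_length n C"
    and dvd: "\<And>x. x \<in> carrier_vec k \<Longrightarrow> x \<noteq> 0\<^sub>v k \<Longrightarrow> l dvd point_mult G (line x)"
    and l: "l > 0"
  obtains m C' where "n = l * m" "linear_code m k C'" "full_length m C'"
    "code_equiv n C (repetition l m C')" "nonzero_weights n C = (\<lambda>w. l * w) ` nonzero_weights m C'"
proof -
  have dim: "dim_row G = k" "dim_col G = n" using G by (auto simp: generator_matrix_def)
  then have col: "col G j \<in> carrier_vec k" for j by auto
  define f where "f j = line (col G j)" for j
  have fibre: "l dvd card {j \<in> {..<n}. f j = b}" for b
  proof (cases "\<exists>j<n. f j = b")
    case True
    then obtain j where j: "j < n" "b = f j" by auto
    have "point_mult G b = card {i \<in> {..<n}. f i = b}"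
      using col dim by (auto simp: point_mult_def span_singleton f_def)
    then show ?thesis using dvd[OF col col_nonzero[OF G full j(1)]] j(2) by (simp add: f_def)
  next
    case False
    then have "{j \<in> {..<n}. f j = b} = {}" by auto
    then show ?thesis by (metis card.empty dvd_0_right)
  qed
  obtain m where n: "n = l * m" using dvd_card_of_fibres[of "{..<n}" l f] fibre by auto
  obtain \<pi> where \<pi>: "\<pi> permutes {..<n}" "\<And>i. i < n \<Longrightarrow> f (\<pi> i) = f (\<pi> (i mod m))"
    using permute_into_periodic_order[of l n f m] fibre n by auto
  have \<pi>_less: "\<pi> i < n" if "i < n" for i using permutes_in_image[OF \<pi>(1), of i] that by simp
  have mod_less: "i mod m < m" if "i < n" for i
    using that n by (cases "m = 0") auto
  have m_le: "m \<le> n" using n l by simp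
  have "\<exists>a. a \<noteq> 0 \<and> col G (\<pi> (i mod m)) = a \<cdot>\<^sub>v col G (\<pi> i)" if i: "i < n" for i
  proof -
    have "col G (\<pi> (i mod m)) \<in> line (col G (\<pi> i))"
      using \<pi>(2)[OF i] in_line_self unfolding f_def by metis
    then obtain c where c: "col G (\<pi> (i mod m)) = c \<cdot>\<^sub>v col G (\<pi> i)" by (auto simp: line_def)
    moreover have "col G (\<pi> (i mod m)) \<noteq> 0\<^sub>v k"
      using mod_less[OF i] m_le by (intro col_nonzero[OF G full] \<pi>_less) simp
    moreover have "0 \<cdot>\<^sub>v col G (\<pi> i) = 0\<^sub>v k" using dim by (intro eq_vecI) auto
    ultimately have "c \<noteq> 0" using c by metis
    then show ?thesis using c by blast
  qed
  then obtain a where a: "\<And>i. i < n \<Longrightarrow> a i \<noteq> 0"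
    "\<And>i. i < n \<Longrightarrow> col G (\<pi> (i mod m)) = a i \<cdot>\<^sub>v col G (\<pi> i)"
    by metis
  have C: "C = codeword G ` carrier_vec k" using bij_betw_codeword[OF G] by (simp add: bij_betw_def)
  have lin: "linear_code n k C" using G by (simp add: generator_matrix_def)
  then have C_carr: "c \<in> carrier_vec n" if "c \<in> C" for c
    using that by (auto simp: linear_code_iff_card)
  have periodic: "a i * c $ \<pi> i = c $ \<pi> (i mod m)" if "c \<in> C" "i < n" for c i
  proof -
    from that obtain h where h: "h \<in> carrier_vec k" "c = codeword G h" using C by auto
    have "\<pi> (i mod m) < n" using mod_less[OF that(2)] m_le by (intro \<pi>_less) simp
    then show ?thesis using h \<pi>_less[OF that(2)] a(2)[OF that(2)] col dim
      by (simp add: codeword_def)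
  qed
  define block where "block c = vec m (\<lambda>i. c $ \<pi> i)" for c :: "'a vec"
  have block_carr: "block c \<in> carrier_vec m" for c by (simp add: block_def)
  have repeat: "vec n (\<lambda>i. a i * c $ \<pi> i) = vec (l * m) (\<lambda>i. block c $ (i mod m))" if "c \<in> C" for c
    using periodic[OF that] mod_less by (auto simp: block_def n)
  have inj: "inj_on block C"
  proof (rule inj_onI)
    fix c d assume cd: "c \<in> C" "d \<in> C" "block c = block d"
    have "c $ \<pi> i = d $ \<pi> i" if i: "i < n" for i
    proof -
      have "a i * c $ \<pi> i = a i * d $ \<pi> i"
        using arg_cong[OF cd(3), of "\<lambda>v. v $ (i mod m)"] periodic cd(1,2) i mod_less[OF i]
        by (simp add: block_def)
      then show ?thesis using a(1)[OF i] by simp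
    qed
    then have "c $ i = d $ i" if "i < n" for i
      using permutes_image[OF \<pi>(1)] that by (metis image_iff lessThan_iff)
    then show "c = d" using C_carr[OF cd(1)] C_carr[OF cd(2)] by (intro eq_vecI) auto
  qed
  have "linear_code m k (block ` C)"
    unfolding linear_code_iff_card
  proof (intro conjI ballI allI)
    show "0\<^sub>v m \<in> block ` C"
    proof
      show "0\<^sub>v n \<in> C" using lin by (simp add: linear_code_iff_card)
      show "0\<^sub>v m = block (0\<^sub>v n)" using \<pi>_less m_le by (auto simp: block_def)
    qed
    show "v + w \<in> block ` C" if "v \<in> block ` C" "w \<in> block ` C" for v w
    proof -
      from that obtain c d where cd: "c \<in> C" "d \<in> C" "v = block c" "w = block d" by auto
      then have "v + w = block (c + d)"
        using \<pi>_less m_le C_carr[OF cd(1)] C_carr[OF cd(2)] by (auto simp: block_def)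
      then show ?thesis using cd(1,2) lin by (simp add: linear_code_iff_card)
    qed
    show "b \<cdot>\<^sub>v v \<in> block ` C" if "v \<in> block ` C" for b v
    proof -
      from that obtain c where c: "c \<in> C" "v = block c" by auto
      then have "b \<cdot>\<^sub>v v = block (b \<cdot>\<^sub>v c)"
        using \<pi>_less m_le C_carr[OF c(1)] by (auto simp: block_def)
      then show ?thesis using c(1) lin by (simp add: linear_code_iff_card)
    qed
    show "card (block ` C) = CARD('a) ^ k"
      using lin by (simp add: card_image[OF inj] linear_code_iff_card)
  qed (use block_carr in auto)
  moreover have "full_length m (block ` C)"
    using full \<pi>_less m_le by (fastforce simp: full_length_def block_def)
  moreover have "code_equiv n C (repetition l m (block ` C))"
    unfolding code_equiv_def repetition_def image_image
    using \<pi>(1) a(1) repeat by (intro exI[of _ \<pi>] exI[of _ a]) (auto intro!: image_cong)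
  moreover have "nonzero_weights n C = (\<lambda>w. l * w) ` nonzero_weights m (block ` C)"
  proof -
    have "weight c = l * weight (block c)" if c: "c \<in> C" for c
      using weight_monomial[OF \<pi>(1) _ C_carr[OF c], of a] a(1)
        weight_repeat[OF block_carr, of l c]
      by (simp add: repeat[OF c])
    moreover have "block ` C - {0\<^sub>v m} = block ` (C - {0\<^sub>v n})"
    proof -
      have "0\<^sub>v n \<in> C" using lin by (simp add: linear_code_iff_card)
      moreover have "block (0\<^sub>v n) = 0\<^sub>v m" using \<pi>_less m_le by (auto simp: block_def)
      ultimately show ?thesis using inj_on_image_set_diff[OF inj, of C "{0\<^sub>v n}"] by simp
    qed
    ultimately show ?thesis unfolding nonzero_weights_def by (simp add: image_image)
  qed
  ultimately show thesis using n by (intro that[of m "block ` C"])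
qed

theorem mainTheorem4:
  fixes C :: "'a :: {finite, field} vec set"
    and p q n k w1 w2 l :: nat
  assumes "prime p" and "q = CARD('a)" and "\<exists>e. q = p ^ e"
    and "linear_code n k C" and "full_length n C"
    and "nonzero_weights n C = {w1, w2}" and "w1 < w2"
    and "\<nexists>j. w2 - w1 = p ^ j"
    and "\<not> full_support n k C"
    and "l = Max {d. d dvd w2 - w1 \<and> coprime d q}"
  shows "repetitive n k C \<and>
    l > 1 \<and> l dvd n \<and> n div l < n \<and>
    (\<exists>C'. linear_code (n div l) k C' \<and> full_length (n div l) C' \<and> two_weight (n div l) C' \<and>
          code_equiv n C (repetition l (n div l) C'))"
proof -
  let ?D = "{d. d dvd w2 - w1 \<and> coprime d q}"
  have finD: "finite ?D" using assms(7) by (intro finite_subset[OF _ finite_divisors_nat]) auto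
  moreover have "1 \<in> ?D" by simp
  ultimately have "l \<in> ?D" unfolding assms(10) by (intro Max_in) auto
  then have l_dvd: "l dvd w2 - w1" and l_coprime: "coprime l q" by auto
  have l: "l > 1"
  proof -
    \<comment> \<open>The part of \<open>w2 - w1\<close> prime to \<open>p\<close> is a candidate for \<open>l\<close>.\<close>
    obtain x where x: "w2 - w1 = p ^ multiplicity p (w2 - w1) * x" "\<not> p dvd x"
      using multiplicity_decompose'[of "w2 - w1" p] assms(1,7)
      by (metis not_prime_unit zero_less_diff less_numeral_extra(3))
    have "x \<noteq> 1" using x(1) assms(8) by (metis mult.right_neutral)
    moreover have "x \<noteq> 0" using x(2) by (metis dvd_0_right)
    moreover have "x \<in> ?D"
    proof -
      have "coprime x p" using x(2) assms(1) by (simp add: coprime_commute prime_imp_coprime)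
      then show ?thesis using assms(3) x(1) by (auto) (metis dvd_triv_right)
    qed
    then have "x \<le> l" unfolding assms(10) by (intro Max_ge finD)
    ultimately show ?thesis by simp
  qed
  obtain G P0 where G: "generator_matrix n k C G" and P0: "P0 \<in> points k" "point_mult G P0 = 0"
    using assms(9) by (auto simp: full_support_def)
  have dvd: "l dvd point_mult G (line x)" if x: "x \<in> carrier_vec k" "x \<noteq> 0\<^sub>v k" for x
  proof -
    have "l dvd CARD('a) ^ k * point_mult G (line x)"
      using l_dvd weight_diff_dvd_point_mult[OF G assms(5,6) less_imp_le[OF assms(7)] P0 x]
      by (rule dvd_trans)
    moreover have "coprime l (CARD('a) ^ k)" using l_coprime assms(2) by simp
    ultimately show ?thesis by (simp add: coprime_dvd_mult_right_iff)
  qed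
  obtain m C' where C': "n = l * m" "linear_code m k C'" "full_length m C'"
    "code_equiv n C (repetition l m C')" "nonzero_weights n C = (\<lambda>w. l * w) ` nonzero_weights m C'"
    by (rule dvd_point_mult_imp_repetition[OF G assms(5) dvd]) (use l in auto)
  have m: "n div l = m" using C'(1) l by simp
  have "card (nonzero_weights n C) = card (nonzero_weights m C')"
    unfolding C'(5) using l by (intro card_image) (auto simp: inj_on_def)
  then have two: "two_weight m C'" using assms(6,7) by (simp add: two_weight_def)
  have "n > 0"
  proof -
    have "w2 \<in> nonzero_weights n C" using assms(6) by simp
    then obtain c where "c \<in> C" "weight c = w2" by (auto simp: nonzero_weights_def)
    moreover from this have "dim_vec c = n" using assms(4) by (auto simp: linear_code_iff_card)
    ultimately show ?thesis using assms(7) by (cases "n = 0") (auto simp: weight_def)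
  qed
  then have "m < n" using C'(1) l by simp
  then show ?thesis
    unfolding repetitive_def m using C' l two m by (metis dvd_triv_left)
qed

end
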